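(* Let $\{X_i : i\in \mathbb{N}\}$ be a collection of real Banach spaces, let $Y_i$ be a closed linear subspace of $X_i$ for every $i\in \mathbb{N}$, and let $1\leq p < \infty$. Let $X=(\oplus_pX_i)_{i \in \mathbb{N}}$, $Y=(\oplus_pY_i)_{i \in \mathbb{N}}$ and $F= \prod_{i \in \mathbb{N}}F_i \in \mathcal{P}(X)$. Then $(Y_i, F_i)$ has the restricted center property for every $i \in \mathbb{N}$ if and only if $(Y, F)$ has the restricted center property. Further, $Z_Y(F)=(\oplus_pZ_{Y_i}(F_i))_{i \in \mathbb{N}}= \prod_{i \in \mathbb{N}}Z_{Y_i}(F_i)$.
   Context: For a real Banach space $X$, $CL(X)$ denotes the set of non-empty closed subsets of $X$, and $CB(X)$ the set of non-empty closed bounded subsets of $X$. For $x\in X$ and $F\in CB(X)$, $r(x,F)=\sup\{\|x-a\|: a\in F\}$. For $V\in CL(X)$, $rad_V(F)=\inf\{r(v,F): v\in V\}$ and $Z_V(F)=\{v\in V: r(v,F)=rad_V(F)\}$. The pair $(V,F)$ has the restricted center property if $Z_V(F)\neq\emptyset$. $(\oplus_p X_i)_{i\in\mathbb{N}}$ is the $\ell_p$-direct sum: all $x=(x_i)_{i\in\mathbb{N}}$ with $x_i\in X_i$ and $\|x\|=(\sum_{i}\|x_i\|^p)^{1/p}<\infty$; $Y=(\oplus_p Y_i)_{i\in\mathbb{N}}$ is regarded as a closed subspace of $X$. For sets $A_i\subseteq X_i$, $(\oplus_p A_i)_{i\in\mathbb{N}}$ denotes the set of $x=(x_i)_{i\in\mathbb{N}}\in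 X$ with $x_i\in A_i$ for all $i$. $\mathcal{P}(X)$ denotes the collection of all $F\in CB(X)$ of the form $F=\prod_{i\in\mathbb{N}}F_i$ (full Cartesian product, contained in $X$) with $F_i\in CB(X_i)$ for every $i$. *)

theory Defs
  imports "HOL-Analysis.Analysis" "HOL-Library.Function_Algebras"
begin

text \<open>
  A real Banach space is given by a carrier, which is a linear subspace of some ambient real vector
  space, together with a norm that is only constrained on the carrier.  A family of Banach spaces
  is then a family of carriers, each with its own norm; the ambient type carries no topology, so
  the spaces are otherwise unrelated.  Topological and metric notions are those of
  \<^locale>\<open>Metric_space\<close> for the carrier and the distance induced by the norm.
\<close>

definition is_normed_space :: "'a::real_vector set \<Rightarrow> ('a \<Rightarrow> real) \<Rightarrow> bool" where
  "is_normed_space V N \<longleftrightarrow> subspace V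
     \<and> (\<forall>x\<in>V. 0 \<le> N x) \<and> (\<forall>x\<in>V. N x = 0 \<longleftrightarrow> x = 0)
     \<and> (\<forall>c. \<forall>x\<in>V. N (c *\<^sub>R x) = \<bar>c\<bar> * N x)
     \<and> (\<forall>x\<in>V. \<forall>y\<in>V. N (x + y) \<le> N x + N y)"

text \<open>
  \<^locale>\<open>Metric_space\<close> asks for nonnegativity and symmetry of the distance on the whole type,
  hence the default value outside the carrier.
\<close>

definition norm_dist :: "'a::ab_group_add set \<Rightarrow> ('a \<Rightarrow> real) \<Rightarrow> 'a \<Rightarrow> 'a \<Rightarrow> real" where
  "norm_dist V N x y = (if x \<in> V \<and> y \<in> V then N (x - y) else 0)"

definition is_banach_space :: "'a::real_vector set \<Rightarrow> ('a \<Rightarrow> real) \<Rightarrow> bool" where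
  "is_banach_space V N \<longleftrightarrow> is_normed_space V N \<and> Metric_space.mcomplete V (norm_dist V N)"

definition CL :: "'a::ab_group_add set \<Rightarrow> ('a \<Rightarrow> real) \<Rightarrow> 'a set set" where
  "CL X N = {A. A \<noteq> {} \<and> closedin (Metric_space.mtopology X (norm_dist X N)) A}"

definition CB :: "'a::ab_group_add set \<Rightarrow> ('a \<Rightarrow> real) \<Rightarrow> 'a set set" where
  "CB X N = {A \<in> CL X N. Metric_space.mbounded X (norm_dist X N) A}"

definition far_radius :: "('a::ab_group_add \<Rightarrow> real) \<Rightarrow> 'a \<Rightarrow> 'a set \<Rightarrow> real" where
  "far_radius N x F = (SUP a\<in>F. N (x - a))"

definition rad :: "('a::ab_group_add \<Rightarrow> real) \<Rightarrow> 'a set \<Rightarrow> 'a set \<Rightarrow> real" where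
  "rad N V F = (INF v\<in>V. far_radius N v F)"

definition cent :: "('a::ab_group_add \<Rightarrow> real) \<Rightarrow> 'a set \<Rightarrow> 'a set \<Rightarrow> 'a set" where
  "cent N V F = {v \<in> V. far_radius N v F = rad N V F}"

definition restricted_center_property ::
  "('a::ab_group_add \<Rightarrow> real) \<Rightarrow> 'a set \<Rightarrow> 'a set \<Rightarrow> bool" where
  "restricted_center_property N V F \<longleftrightarrow> cent N V F \<noteq> {}"

text \<open>
  The \<open>p\<close>-direct sum of the subsets \<open>A i\<close> of the spaces with norms \<open>N i\<close>.  The summability
  condition is exactly finiteness of the norm, as \<open>suminf\<close> is unspecified on divergent series.
\<close>

definition lp_sum :: "real \<Rightarrow> (nat \<Rightarrow> 'a \<Rightarrow> real) \<Rightarrow> (nat \<Rightarrow> 'a set) \<Rightarrow> (nat \<Rightarrow> 'a) set" where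
  "lp_sum p N A = {x. (\<forall>i. x i \<in> A i) \<and> summable (\<lambda>i. N i (x i) powr p)}"

definition lp_norm :: "real \<Rightarrow> (nat \<Rightarrow> 'a \<Rightarrow> real) \<Rightarrow> (nat \<Rightarrow> 'a) \<Rightarrow> real" where
  "lp_norm p N x = (\<Sum>i. N i (x i) powr p) powr (1 / p)"

definition product_CB ::
  "real \<Rightarrow> (nat \<Rightarrow> 'a::ab_group_add \<Rightarrow> real) \<Rightarrow> (nat \<Rightarrow> 'a set) \<Rightarrow> (nat \<Rightarrow> 'a) set set" where
  "product_CB p N X = {F \<in> CB (lp_sum p N X) (lp_norm p N).
     \<exists>G. (\<forall>i. G i \<in> CB (X i) (N i)) \<and> F = Pi UNIV G}"

text \<open>
  The distance of the \<open>p\<close>-direct sum is a metric, so that the notions from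
  \<^locale>\<open>Metric_space\<close> have their intended meaning there as well.
\<close>

lemma powr_convex_combination_le:
  fixes u v t p :: real
  assumes "1 \<le> p" "0 \<le> u" "0 \<le> v" "0 < t" "t < 1"
  shows "(t * u + (1 - t) * v) powr p \<le> t * u powr p + (1 - t) * v powr p"
proof -
  have aux: "(s * w) powr p \<le> s * w powr p" if "0 < s" "s < 1" "0 \<le> w" for s w
  proof -
    have "s powr p \<le> s powr 1"
      using that assms by (intro powr_mono') auto
    then show ?thesis
      using that by (simp add: powr_mult mult_right_mono)
  qed
  consider "u = 0" | "v = 0" | "0 < u" "0 < v"
    using assms by linarith
  then show ?thesis
  proof cases
    case 1
    then show ?thesis using aux[of "1 - t" v] assms by simp
  next
    case 2
    then show ?thesis using aux[of t u] assms by simp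
  next
    case 3
    then show ?thesis
      using convex_onD[OF powr_convex[OF assms(1)], of "1 - t" u v] assms by simp
  qed
qed

lemma minkowski_powr:
  fixes f g h :: "nat \<Rightarrow> real"
  assumes p: "1 \<le> p" and f: "\<And>i. 0 \<le> f i" and g: "\<And>i. 0 \<le> g i"
    and h: "\<And>i. 0 \<le> h i" "\<And>i. h i \<le> f i + g i"
    and sf: "summable (\<lambda>i. f i powr p)" and sg: "summable (\<lambda>i. g i powr p)"
  shows "summable (\<lambda>i. h i powr p)"
    and "(\<Sum>i. h i powr p) powr (1 / p)
           \<le> (\<Sum>i. f i powr p) powr (1 / p) + (\<Sum>i. g i powr p) powr (1 / p)"
proof -
  define A where "A = (\<Sum>i. f i powr p) powr (1 / p)"
  define B where "B = (\<Sum>i. g i powr p) powr (1 / p)"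
  have AB: "A \<ge> 0" "B \<ge> 0" by (auto simp: A_def B_def)
  have Ap: "A powr p = (\<Sum>i. f i powr p)" and Bp: "B powr p = (\<Sum>i. g i powr p)"
    using p by (auto simp: A_def B_def powr_powr suminf_nonneg sf sg)
  have *: "summable (\<lambda>i. h i powr p) \<and> (\<Sum>i. h i powr p) powr (1 / p) \<le> a + b"
    if ab: "A < a" "B < b" for a b
  proof -
    have pos: "a > 0" "b > 0" using AB ab by auto
    define t where "t = a / (a + b)"
    have t: "0 < t" "t < 1" "1 - t = b / (a + b)"
      using pos by (auto simp: t_def field_simps)
    have le: "h i powr p \<le> (a + b) powr p *
        (t * (f i powr p / a powr p) + (1 - t) * (g i powr p / b powr p))" for i
    proof -
      have eq: "f i + g i = (a + b) * (t * (f i / a) + (1 - t) * (g i / b))"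
        unfolding t(3) using pos by (simp add: t_def add_divide_distrib distrib_left)
      have "(t * (f i / a) + (1 - t) * (g i / b)) powr p
          \<le> t * (f i / a) powr p + (1 - t) * (g i / b) powr p"
        using f g pos t(1,2) by (intro powr_convex_combination_le p) auto
      then have "(a + b) powr p * (t * (f i / a) + (1 - t) * (g i / b)) powr p \<le> (a + b) powr p *
          (t * (f i / a) powr p + (1 - t) * (g i / b) powr p)"
        by (rule mult_left_mono) simp
      then have "(f i + g i) powr p \<le> (a + b) powr p *
          (t * (f i / a) powr p + (1 - t) * (g i / b) powr p)"
        unfolding eq by (simp only: powr_mult)
      moreover have "h i powr p \<le> (f i + g i) powr p"
        using h p by (intro powr_mono2) auto
      ultimately show ?thesis by (simp only: powr_divide)
    qed
    have S: "(\<lambda>i. (a + b) powr p *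
        (t * (f i powr p / a powr p) + (1 - t) * (g i powr p / b powr p)))
      sums ((a + b) powr p * (t * (A powr p / a powr p) + (1 - t) * (B powr p / b powr p)))"
      unfolding Ap Bp
      by (intro sums_mult sums_add sums_divide summable_sums sf sg)
    have sh: "summable (\<lambda>i. h i powr p)"
      by (rule summable_comparison_test'[OF sums_summable[OF S]]) (use le in \<open>simp only: real_norm_def abs_of_nonneg powr_ge_zero\<close>)
    have "(\<Sum>i. h i powr p)
        \<le> (a + b) powr p * (t * (A powr p / a powr p) + (1 - t) * (B powr p / b powr p))"
      by (rule sums_le[OF le summable_sums[OF sh] S])
    also have "\<dots> \<le> (a + b) powr p * (t * 1 + (1 - t) * 1)"
      using ab pos AB t(1,2) p
      by (intro mult_left_mono add_mono) (auto intro!: powr_mono2)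
    finally have "(\<Sum>i. h i powr p) \<le> (a + b) powr p" by simp
    then have "(\<Sum>i. h i powr p) powr (1 / p) \<le> ((a + b) powr p) powr (1 / p)"
      using p by (intro powr_mono2) (auto intro!: suminf_nonneg sh)
    then show ?thesis using p pos sh by (simp add: powr_powr)
  qed
  show "summable (\<lambda>i. h i powr p)" using *[of "A + 1" "B + 1"] by simp
  have "(\<Sum>i. h i powr p) powr (1 / p) \<le> A + B + e" if "e > 0" for e
    using *[of "A + e / 2" "B + e / 2"] that by simp
  then have "(\<Sum>i. h i powr p) powr (1 / p) \<le> A + B"
    by (rule field_le_epsilon)
  then show "(\<Sum>i. h i powr p) powr (1 / p)
           \<le> (\<Sum>i. f i powr p) powr (1 / p) + (\<Sum>i. g i powr p) powr (1 / p)"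
    by (simp add: A_def B_def)
qed

lemma is_normed_spaceD:
  assumes "is_normed_space V N"
  shows "subspace V" and "0 \<in> V" and "\<And>x. x \<in> V \<Longrightarrow> 0 \<le> N x"
    and "\<And>x. x \<in> V \<Longrightarrow> N x = 0 \<longleftrightarrow> x = 0"
    and "\<And>x y. x \<in> V \<Longrightarrow> y \<in> V \<Longrightarrow> x - y \<in> V"
proof -
  show sub: "subspace V"
    using assms by (simp only: is_normed_space_def)
  show "0 \<in> V" by (rule subspace_0[OF sub])
  show "x - y \<in> V" if "x \<in> V" "y \<in> V" for x y
    by (rule subspace_diff[OF sub that])
  have "\<forall>x\<in>V. 0 \<le> N x"
    using assms unfolding is_normed_space_def by (elim conjE)
  then show "0 \<le> N x" if "x \<in> V" for x
    by (rule bspec[OF _ that])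
  have "\<forall>x\<in>V. N x = 0 \<longleftrightarrow> x = 0"
    using assms unfolding is_normed_space_def by (elim conjE)
  then show "N x = 0 \<longleftrightarrow> x = 0" if "x \<in> V" for x
    by (rule bspec[OF _ that])
qed

lemma norm_minus_commute_on:
  assumes "is_normed_space V N" "x \<in> V" "y \<in> V"
  shows "N (x - y) = N (y - x)"
proof -
  have "N ((-1) *\<^sub>R (x - y)) = \<bar>-1\<bar> * N (x - y)"
    using assms subspace_diff[of V x y] unfolding is_normed_space_def by blast
  then show ?thesis by simp
qed

lemma norm_diff_triangle_on:
  assumes "is_normed_space V N" "x \<in> V" "y \<in> V" "z \<in> V"
  shows "N (x - z) \<le> N (x - y) + N (y - z)"
proof -
  have "x - y \<in> V" "y - z \<in> V" "x - z = (x - y) + (y - z)"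
    using assms by (auto simp: is_normed_space_def subspace_diff)
  then show ?thesis using assms(1) unfolding is_normed_space_def by metis
qed

lemma Metric_space_norm_dist:
  assumes "is_normed_space V N"
  shows "Metric_space V (norm_dist V N)"
proof
  have sub: "subspace V" using assms by (simp add: is_normed_space_def)
  have nn: "0 \<le> N v" if "v \<in> V" for v
    using assms that by (simp add: is_normed_space_def)
  show "0 \<le> norm_dist V N x y" for x y
    using nn sub by (simp add: norm_dist_def subspace_diff)
  show "norm_dist V N x y = norm_dist V N y x" for x y
    using norm_minus_commute_on[OF assms] by (simp add: norm_dist_def)
  show "norm_dist V N x y = 0 \<longleftrightarrow> x = y" if "x \<in> V" "y \<in> V" for x y
    using assms that subspace_diff[OF sub that] by (simp add: is_normed_space_def norm_dist_def)
  show "norm_dist V N x z \<le> norm_dist V N x y + norm_dist V N y z"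
    if "x \<in> V" "y \<in> V" "z \<in> V" for x y z
    using norm_diff_triangle_on[OF assms that] that by (simp add: norm_dist_def)
qed

lemma lp_sum_diff:
  assumes p: "1 \<le> p" and N: "\<And>i. is_normed_space (X i) (N i)"
    and x: "x \<in> lp_sum p N X" and y: "y \<in> lp_sum p N X"
  shows "x - y \<in> lp_sum p N X"
proof -
  note D = is_normed_spaceD[OF N]
  have X: "x i \<in> X i" "y i \<in> X i" for i
    using x y by (simp_all add: lp_sum_def)
  have "summable (\<lambda>i. N i (x i - y i) powr p)"
  proof (rule minkowski_powr(1)[OF p])
    show "N i (x i - y i) \<le> N i (x i) + N i (y i)" for i
      using norm_diff_triangle_on[OF N X(1) D(2) X(2), of i]
        norm_minus_commute_on[OF N D(2) X(2), of i] by (simp only: diff_0_right)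
    show "summable (\<lambda>i. N i (x i) powr p)" "summable (\<lambda>i. N i (y i) powr p)"
      using x y by (simp_all add: lp_sum_def)
  qed (rule D(3,5) X)+
  then show ?thesis
    using D(5)[OF X] by (simp add: lp_sum_def)
qed

lemma Metric_space_lp_sum:
  assumes p: "1 \<le> p" and N: "\<And>i. is_normed_space (X i) (N i)"
  shows "Metric_space (lp_sum p N X) (norm_dist (lp_sum p N X) (lp_norm p N))"
proof
  let ?S = "lp_sum p N X"
  have X: "x i \<in> X i" if "x \<in> ?S" for x i
    using that by (simp add: lp_sum_def)
  note D = is_normed_spaceD[OF N]
  have summ: "summable (\<lambda>i. N i (x i - y i) powr p)" if "x \<in> ?S" "y \<in> ?S" for x y
    using lp_sum_diff[OF p N that] by (simp add: lp_sum_def)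
  show "0 \<le> norm_dist ?S (lp_norm p N) x y" for x y
    by (simp add: norm_dist_def lp_norm_def)
  show "norm_dist ?S (lp_norm p N) x y = norm_dist ?S (lp_norm p N) y x" for x y
  proof (cases "x \<in> ?S \<and> y \<in> ?S")
    case True
    then have "N i (x i - y i) = N i (y i - x i)" for i
      using X by (intro norm_minus_commute_on[OF N]) auto
    then have "lp_norm p N (x - y) = lp_norm p N (y - x)"
      by (simp only: lp_norm_def fun_diff_def)
    then show ?thesis
      by (simp only: norm_dist_def conj_commute)
  qed (auto simp: norm_dist_def)
  show "norm_dist ?S (lp_norm p N) x y = 0 \<longleftrightarrow> x = y" if S: "x \<in> ?S" "y \<in> ?S" for x y
  proof -
    have "(N i (x i - y i) = 0) = (x i = y i)" for i
      using D(4)[OF D(5)[OF X[OF S(1)] X[OF S(2)]]] by (simp only: right_minus_eq)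
    moreover have "(\<Sum>i. N i (x i - y i) powr p) = 0 \<longleftrightarrow> (\<forall>i. N i (x i - y i) powr p = 0)"
      by (rule suminf_eq_zero_iff[OF summ[OF S]]) simp
    ultimately show ?thesis
      using S by (simp add: norm_dist_def lp_norm_def fun_eq_iff)
  qed
  show "norm_dist ?S (lp_norm p N) x z \<le> norm_dist ?S (lp_norm p N) x y + norm_dist ?S (lp_norm p N) y z"
    if S: "x \<in> ?S" "y \<in> ?S" "z \<in> ?S" for x y z
  proof -
    have "(\<Sum>i. N i (x i - z i) powr p) powr (1 / p)
        \<le> (\<Sum>i. N i (x i - y i) powr p) powr (1 / p)
          + (\<Sum>i. N i (y i - z i) powr p) powr (1 / p)"
    proof (rule minkowski_powr(2)[OF p])
      show "N i (x i - z i) \<le> N i (x i - y i) + N i (y i - z i)" for i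
        by (rule norm_diff_triangle_on[OF N X[OF S(1)] X[OF S(2)] X[OF S(3)]])
    qed (rule D(3,5) X summ S)+
    then show ?thesis using S by (simp add: norm_dist_def lp_norm_def)
  qed
qed

end

theory Submission
  imports Defs
begin

text \<open>
  Choosing in every coordinate an almost farthest point of \<open>F\<^sub>i\<close> shows
  \<open>r(x, F)\<^sup>p = (\<Sum>i. r(x\<^sub>i, F\<^sub>i)\<^sup>p)\<close>, the right-hand side being finite because the chosen points
  form an element of \<open>F\<close>, which lies in the \<open>p\<close>-direct sum.  Hence \<open>v\<close> minimises
  \<open>r(\<cdot>, F)\<close> over \<open>Y\<close> as soon as each \<open>v\<^sub>i\<close> minimises \<open>r(\<cdot>, F\<^sub>i)\<close> over \<open>Y\<^sub>i\<close>; conversely, a minimiser \<open>v\<close>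
  could be improved by changing a single coordinate that is not a minimiser.  Any family of
  coordinatewise minimisers lies in the \<open>p\<close>-direct sum, because \<open>r(v\<^sub>i, F\<^sub>i) \<le> r(0, F\<^sub>i)\<close>.
\<close>

section \<open>Farthest-point radii and centers in a single space\<close>

lemma CB_props:
  assumes V: "is_normed_space V N" and F: "F \<in> CB V N"
  shows "F \<noteq> {}" and "F \<subseteq> V" and "x \<in> V \<Longrightarrow> bdd_above ((\<lambda>a. N (x - a)) ` F)"
proof -
  interpret Metric_space V "norm_dist V N"
    by (rule Metric_space_norm_dist[OF V])
  show "F \<noteq> {}" using F by (simp add: CB_def CL_def)
  show sub: "F \<subseteq> V"
    using F closedin_subset[of mtopology F] by (simp add: CB_def CL_def)
  assume x: "x \<in> V"
  from F obtain c B where c: "F \<subseteq> mcball c B"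
    by (auto simp: CB_def mbounded_def)
  \<comment> \<open>The ball is centred at some \<open>c\<close>; the triangle inequality moves the
    bound to an arbitrary \<open>x\<close>, which makes \<open>far_radius\<close> a genuine
    supremum.\<close>
  have "N (x - a) \<le> N (x - c) + B" if "a \<in> F" for a
  proof -
    have "c \<in> V" "a \<in> V" "N (c - a) \<le> B"
      using that c by (auto simp: norm_dist_def in_mcball subset_iff)
    then show ?thesis
      using norm_diff_triangle_on[OF V x, of c a] by linarith
  qed
  then show "bdd_above ((\<lambda>a. N (x - a)) ` F)"
    by (rule bdd_aboveI2)
qed

lemma norm_diff_le_far_radius:
  assumes "is_normed_space V N" "F \<in> CB V N" "x \<in> V" "a \<in> F"
  shows "N (x - a) \<le> far_radius N x F"
  unfolding far_radius_def by (rule cSUP_upper[OF assms(4) CB_props(3)[OF assms(1-3)]])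

lemma far_radius_nonneg:
  assumes V: "is_normed_space V N" and F: "F \<in> CB V N" and x: "x \<in> V"
  shows "0 \<le> far_radius N x F"
proof -
  obtain a where a: "a \<in> F" using CB_props(1)[OF V F] by blast
  then have "0 \<le> N (x - a)"
    using is_normed_spaceD(3,5)[OF V] CB_props(2)[OF V F] x by blast
  then show ?thesis using norm_diff_le_far_radius[OF V F x a] by linarith
qed

text \<open>The error is a factor \<open>t\<close> rather than a summand: one \<open>t\<close> then
  serves all coordinates at once and leaves the \<open>p\<close>-th powers as the common factor
  \<open>t powr p\<close>.\<close>

lemma exists_almost_farthest:
  assumes V: "is_normed_space V N" and F: "F \<in> CB V N" and x: "x \<in> V" and t: "0 < t" "t < 1"
  shows "\<exists>a\<in>F. t * far_radius N x F \<le> N (x - a)"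
\<comment> \<open>At radius 0 the strict inequality used in the other case fails, but any point of
  \<open>F\<close> will do.\<close>
proof (cases "far_radius N x F = 0")
  case True
  obtain a where a: "a \<in> F" using CB_props(1)[OF V F] by blast
  then have "0 \<le> N (x - a)"
    using is_normed_spaceD(3,5)[OF V] CB_props(2)[OF V F] x by blast
  then show ?thesis using True a by auto
next
  case False
  then have "t * far_radius N x F < far_radius N x F"
    using far_radius_nonneg[OF V F x] t by simp
  then have "\<exists>a\<in>F. t * far_radius N x F < N (x - a)"
    by (subst (asm) (2) far_radius_def) (simp add: less_cSUP_iff CB_props[OF V F] x)
  then show ?thesis by (auto intro: less_imp_le)
qed

text \<open>Nonnegative radii are bounded below, so \<open>rad\<close> is a true infimum and can be
  replaced by pairwise comparison.\<close>

lemma cent_iff_minimizer: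
  assumes "\<And>w. w \<in> V \<Longrightarrow> 0 \<le> far_radius N w F"
  shows "v \<in> cent N V F \<longleftrightarrow> v \<in> V \<and> (\<forall>w\<in>V. far_radius N v F \<le> far_radius N w F)"
proof -
  have "bdd_below ((\<lambda>w. far_radius N w F) ` V)"
    using assms by (rule bdd_belowI2)
  then have low: "rad N V F \<le> far_radius N w F" if "w \<in> V" for w
    unfolding rad_def using that by (rule cINF_lower)
  show ?thesis
  proof
    assume "v \<in> cent N V F"
    then show "v \<in> V \<and> (\<forall>w\<in>V. far_radius N v F \<le> far_radius N w F)"
      using low by (auto simp: cent_def)
  next
    assume v: "v \<in> V \<and> (\<forall>w\<in>V. far_radius N v F \<le> far_radius N w F)"
    then have "far_radius N v F \<le> rad N V F"
      unfolding rad_def by (intro cINF_greatest) auto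
    then show "v \<in> cent N V F" using v low[of v] by (simp add: cent_def)
  qed
qed

section \<open>Radii of product sets\<close>

text \<open>By \<open>product_subset\<close>, every choice of points from the \<open>F i\<close> has
  \<open>p\<close>-summable norms; the summability of the radii rests on this.\<close>

locale lp_product =
  fixes X F :: "nat \<Rightarrow> 'a::real_vector set" and N :: "nat \<Rightarrow> 'a \<Rightarrow> real" and p :: real
  assumes normed: "is_normed_space (X i) (N i)"
    and p: "1 \<le> p"
    and CB: "F i \<in> CB (X i) (N i)"
    and product_subset: "Pi UNIV F \<subseteq> lp_sum p N X"
begin

abbreviation r :: "nat \<Rightarrow> 'a \<Rightarrow> real" where
  "r i x \<equiv> far_radius (N i) x (F i)"

lemmas r_nonneg = far_radius_nonneg[OF normed CB]

text \<open>Both claims come from one selection \<open>a\<close> of almost farthest points: the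
  summable powers of \<open>N i (x i - a i)\<close> dominate \<open>t powr p\<close> times those of
  the radii.\<close>

lemma summable_r:
  assumes x: "x \<in> lp_sum p N X"
  shows "summable (\<lambda>i. r i (x i) powr p)"
    and "0 < t \<Longrightarrow> t < 1 \<Longrightarrow> \<exists>a\<in>Pi UNIV F. t * (\<Sum>i. r i (x i) powr p) powr (1 / p) \<le> lp_norm p N (x - a)"
proof -
  have X: "x i \<in> X i" for i using x by (simp add: lp_sum_def)
  have *: "summable (\<lambda>i. r i (x i) powr p) \<and>
      (\<exists>a\<in>Pi UNIV F. t * (\<Sum>i. r i (x i) powr p) powr (1 / p) \<le> lp_norm p N (x - a))"
    if t: "0 < t" "t < 1" for t
  proof -
    obtain a where a: "\<And>i. a i \<in> F i" "\<And>i. t * r i (x i) \<le> N i (x i - a i)"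
      using exists_almost_farthest[OF normed CB X t] by metis
    then have aF: "a \<in> Pi UNIV F" by simp
    then have "x - a \<in> lp_sum p N X"
      using product_subset by (intro lp_sum_diff[OF p normed x]) auto
    then have sum_a: "summable (\<lambda>i. N i (x i - a i) powr p)"
      by (simp add: lp_sum_def)
    have le: "t powr p * r i (x i) powr p \<le> N i (x i - a i) powr p" for i
      using powr_mono2[OF _ _ a(2)[of i], of p] p t r_nonneg[OF X] by (simp add: powr_mult)
    have sum_t: "summable (\<lambda>i. t powr p * r i (x i) powr p)"
      by (rule summable_comparison_test'[OF sum_a]) (use le in simp)
    then have sum_r: "summable (\<lambda>i. r i (x i) powr p)"
      using t by (simp add: summable_cmult_iff)
    have "t powr p * (\<Sum>i. r i (x i) powr p) \<le> (\<Sum>i. N i (x i - a i) powr p)"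
      using suminf_le[OF le sum_t sum_a] by (simp add: suminf_mult[OF sum_r])
    then have "(t powr p * (\<Sum>i. r i (x i) powr p)) powr (1 / p)
        \<le> (\<Sum>i. N i (x i - a i) powr p) powr (1 / p)"
      using p by (intro powr_mono2) (auto intro!: mult_nonneg_nonneg suminf_nonneg sum_r)
    then have "t * (\<Sum>i. r i (x i) powr p) powr (1 / p) \<le> lp_norm p N (x - a)"
      using p t by (simp add: powr_mult powr_powr lp_norm_def)
    then show ?thesis using sum_r aF by blast
  qed
  \<comment> \<open>The claim does not mention \<open>t\<close>, so any value strictly between 0 and
    1 works.\<close>
  show "summable (\<lambda>i. r i (x i) powr p)" using *[of "1 / 2"] by simp
  show "\<exists>a\<in>Pi UNIV F. t * (\<Sum>i. r i (x i) powr p) powr (1 / p) \<le> lp_norm p N (x - a)"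
    if "0 < t" "t < 1" using *[OF that] by blast
qed

lemma far_radius_product:
  assumes x: "x \<in> lp_sum p N X"
  shows "far_radius (lp_norm p N) x (Pi UNIV F) = (\<Sum>i. r i (x i) powr p) powr (1 / p)"
proof -
  let ?R = "(\<Sum>i. r i (x i) powr p) powr (1 / p)"
  have X: "x i \<in> X i" for i using x by (simp add: lp_sum_def)
  have le: "lp_norm p N (x - a) \<le> ?R" if a: "a \<in> Pi UNIV F" for a
  proof -
    have diff: "x - a \<in> lp_sum p N X"
      using product_subset a by (intro lp_sum_diff[OF p normed x]) auto
    then have s: "summable (\<lambda>i. N i (x i - a i) powr p)" and "x i - a i \<in> X i" for i
      by (simp_all add: lp_sum_def)
    then have "N i (x i - a i) powr p \<le> r i (x i) powr p" for i
      using norm_diff_le_far_radius[OF normed CB X, of "a i" i] a p is_normed_spaceD(3)[OF normed]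
      by (intro powr_mono2) auto
    then have "(\<Sum>i. N i (x i - a i) powr p) \<le> (\<Sum>i. r i (x i) powr p)"
      by (rule suminf_le[OF _ s summable_r(1)[OF x]])
    then show ?thesis
      using p by (auto simp: lp_norm_def intro!: powr_mono2 suminf_nonneg s)
  qed
  have "Pi UNIV F \<noteq> {}" using CB_props(1)[OF normed CB] by (simp add: Pi_eq_empty)
  then have "far_radius (lp_norm p N) x (Pi UNIV F) \<le> ?R"
    unfolding far_radius_def[of "lp_norm p N"] using le by (rule cSUP_least)
  moreover have "?R \<le> far_radius (lp_norm p N) x (Pi UNIV F)"
  \<comment> \<open>Letting \<open>t\<close> tend to 1 removes the loss in the selection.\<close>
  proof (rule field_le_mult_one_interval)
    fix t :: real assume "0 < t" "t < 1"
    then obtain a where a: "a \<in> Pi UNIV F" "t * ?R \<le> lp_norm p N (x - a)"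
      using summable_r(2)[OF x] by blast
    have "lp_norm p N (x - a) \<le> far_radius (lp_norm p N) x (Pi UNIV F)"
      unfolding far_radius_def[of "lp_norm p N"] by (rule cSUP_upper[OF a(1) bdd_aboveI2[OF le]])
    then show "t * ?R \<le> far_radius (lp_norm p N) x (Pi UNIV F)"
      using a(2) by linarith
  qed
  ultimately show ?thesis by linarith
qed

text \<open>Passing through any \<open>a\<close> in the product bounds \<open>N i (x i)\<close> by
  the radius plus \<open>N i (a i)\<close>, and Minkowski's inequality adds the two summable
  families.\<close>

lemma lp_sumI_far_radius:
  assumes X: "\<And>i. x i \<in> X i" and s: "summable (\<lambda>i. r i (x i) powr p)"
  shows "x \<in> lp_sum p N X"
proof -
  have "\<forall>i. \<exists>a. a \<in> F i" using CB_props(1)[OF normed CB] by blast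
  then obtain a where a: "\<And>i. a i \<in> F i" by metis
  then have "a \<in> lp_sum p N X" using product_subset by auto
  then have aX: "\<And>i. a i \<in> X i" and sa: "summable (\<lambda>i. N i (a i) powr p)"
    by (simp_all add: lp_sum_def)
  note D = is_normed_spaceD[OF normed]
  have "N i (x i) \<le> r i (x i) + N i (a i)" for i
    using norm_diff_triangle_on[OF normed X aX D(2), of i]
      norm_diff_le_far_radius[OF normed CB X a, of i] by simp
  then have "summable (\<lambda>i. N i (x i) powr p)"
    by (intro minkowski_powr(1)[OF p _ _ _ _ s sa] r_nonneg D(3) X aX) auto
  then show ?thesis using X by (simp add: lp_sum_def)
qed

section \<open>Centers of product sets\<close>

lemma cent_product:
  assumes sub: "\<And>i. Y i \<subseteq> X i" and zero: "\<And>i. 0 \<in> Y i"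
  shows "cent (lp_norm p N) (lp_sum p N Y) (Pi UNIV F) = (\<Pi> i\<in>UNIV. cent (N i) (Y i) (F i))"
    and "lp_sum p N (\<lambda>i. cent (N i) (Y i) (F i)) = (\<Pi> i\<in>UNIV. cent (N i) (Y i) (F i))"
proof -
  have lp_iff: "x \<in> lp_sum p N Y \<longleftrightarrow> (\<forall>i. x i \<in> Y i) \<and> x \<in> lp_sum p N X" for x
    using sub by (auto simp: lp_sum_def)
  have YX: "\<And>i y. y \<in> Y i \<Longrightarrow> y \<in> X i" using sub by blast
  have cent_i: "v \<in> cent (N i) (Y i) (F i) \<longleftrightarrow> v \<in> Y i \<and> (\<forall>w\<in>Y i. r i v \<le> r i w)" for i v
    by (rule cent_iff_minimizer) (rule r_nonneg[OF YX])
  have cent_p: "v \<in> cent (lp_norm p N) (lp_sum p N Y) (Pi UNIV F) \<longleftrightarrow> v \<in> lp_sum p N Y \<and>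
      (\<forall>w\<in>lp_sum p N Y. (\<Sum>i. r i (v i) powr p) \<le> (\<Sum>i. r i (w i) powr p))" for v
  proof -
    have "far_radius (lp_norm p N) v (Pi UNIV F) \<le> far_radius (lp_norm p N) w (Pi UNIV F)
        \<longleftrightarrow> (\<Sum>i. r i (v i) powr p) \<le> (\<Sum>i. r i (w i) powr p)"
      if "v \<in> lp_sum p N Y" "w \<in> lp_sum p N Y" for w
    proof -
      have X: "v \<in> lp_sum p N X" "w \<in> lp_sum p N X" using that lp_iff by auto
      have "0 \<le> (\<Sum>i. r i (v i) powr p)" "0 \<le> (\<Sum>i. r i (w i) powr p)"
        by (auto intro!: suminf_nonneg summable_r X)
      then show ?thesis
        unfolding far_radius_product[OF X(1)] far_radius_product[OF X(2)]
        using p powr_mono2[of "1 / p"] powr_less_mono2[of "1 / p"]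
        by (meson less_eq_real_def linorder_not_less zero_less_divide_1_iff zero_less_one order_less_le_trans)
    qed
    moreover have "0 \<le> far_radius (lp_norm p N) w (Pi UNIV F)" if "w \<in> lp_sum p N Y" for w
      using that lp_iff by (simp add: far_radius_product)
    ultimately show ?thesis by (subst cent_iff_minimizer) blast+
  qed
  have cent_lp: "v \<in> lp_sum p N Y" if v: "\<And>i. v i \<in> cent (N i) (Y i) (F i)" for v
  proof -
    have "N i 0 = 0" "0 \<in> X i" for i
      using is_normed_spaceD(2,4)[OF normed[of i]] by auto
    then have "(\<lambda>i. 0) \<in> lp_sum p N X" by (simp add: lp_sum_def)
    note s0 = summable_r(1)[OF this]
    \<comment> \<open>The competitor 0 lies in every \<open>Y i\<close>, and the zero sequence has
      summable radii.\<close>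
    have "r i (v i) powr p \<le> r i 0 powr p" for i
      using v[of i] zero p r_nonneg[OF YX] by (intro powr_mono2) (auto simp: cent_i)
    then have "summable (\<lambda>i. r i (v i) powr p)"
      by (intro summable_comparison_test'[OF s0]) simp
    then show ?thesis
      using v YX unfolding lp_iff by (auto simp: cent_i intro!: lp_sumI_far_radius)
  qed
  then show "lp_sum p N (\<lambda>i. cent (N i) (Y i) (F i)) = (\<Pi> i\<in>UNIV. cent (N i) (Y i) (F i))"
    by (auto simp: lp_sum_def)
  show "cent (lp_norm p N) (lp_sum p N Y) (Pi UNIV F) = (\<Pi> i\<in>UNIV. cent (N i) (Y i) (F i))"
  proof (intro equalityI subsetI)
    fix v assume "v \<in> (\<Pi> i\<in>UNIV. cent (N i) (Y i) (F i))"
    then have v: "\<And>i. v i \<in> cent (N i) (Y i) (F i)" by auto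
    have "(\<Sum>i. r i (v i) powr p) \<le> (\<Sum>i. r i (w i) powr p)" if w: "w \<in> lp_sum p N Y" for w
    proof (rule suminf_le)
      show "r i (v i) powr p \<le> r i (w i) powr p" for i
        using v[of i] w p r_nonneg[OF YX] by (intro powr_mono2) (auto simp: cent_i lp_iff)
    qed (use cent_lp[OF v] w lp_iff summable_r(1) in auto)
    then show "v \<in> cent (lp_norm p N) (lp_sum p N Y) (Pi UNIV F)"
      using cent_lp[OF v] by (simp add: cent_p)
  next
    fix v assume v: "v \<in> cent (lp_norm p N) (lp_sum p N Y) (Pi UNIV F)"
    then have vY: "\<And>i. v i \<in> Y i" and vX: "v \<in> lp_sum p N X" by (auto simp: cent_p lp_iff)
    note sv = summable_r(1)[OF vX]
    have "r j (v j) \<le> r j w" if w: "w \<in> Y j" for j w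
    proof (rule ccontr)
      assume "\<not> r j (v j) \<le> r j w"
      then have less: "r j w powr p < r j (v j) powr p"
        using r_nonneg[OF YX[OF w]] p by (intro powr_less_mono2) auto
      let ?u = "v(j := w)"
      \<comment> \<open>Changing one term keeps the series summable, which puts \<open>?u\<close>
        back into the \<open>p\<close>-direct sum.\<close>
      have "\<forall>\<^sub>F i in sequentially. r i (?u i) powr p = r i (v i) powr p"
        using eventually_gt_at_top[of j] by eventually_elim simp
      then have su: "summable (\<lambda>i. r i (?u i) powr p)"
        by (rule iffD2[OF summable_cong sv])
      have uY: "?u i \<in> Y i" for i using vY w by simp
      then have u: "?u \<in> lp_sum p N Y"
        unfolding lp_iff using lp_sumI_far_radius[OF YX su] by blast
      \<comment> \<open>The difference series has a positive term at \<open>j\<close> and zeros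
        elsewhere.\<close>
      have "0 < (\<Sum>i. r i (v i) powr p - r i (?u i) powr p)"
        by (rule suminf_pos2[OF summable_diff[OF sv su], of j]) (use less in auto)
      also have "\<dots> = (\<Sum>i. r i (v i) powr p) - (\<Sum>i. r i (?u i) powr p)"
        by (rule suminf_diff[OF sv su, symmetric])
      finally show False using v u by (auto simp: cent_p)
    qed
    then show "v \<in> (\<Pi> i\<in>UNIV. cent (N i) (Y i) (F i))" using vY by (simp add: cent_i)
  qed
qed

end

theorem theorem2p2:
  fixes X Y F :: "nat \<Rightarrow> 'a::real_vector set"
    and N :: "nat \<Rightarrow> 'a \<Rightarrow> real"
    and p :: real
  assumes "\<And>i. is_banach_space (X i) (N i)"
    and "\<And>i. Y i \<subseteq> X i"
    and "\<And>i. subspace (Y i)"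
    and "\<And>i. closedin (Metric_space.mtopology (X i) (norm_dist (X i) (N i))) (Y i)"
    and "1 \<le> p"
    and "\<And>i. F i \<in> CB (X i) (N i)"
    and "Pi UNIV F \<in> product_CB p N X"
  shows "((\<forall>i. restricted_center_property (N i) (Y i) (F i)) \<longleftrightarrow>
           restricted_center_property (lp_norm p N) (lp_sum p N Y) (Pi UNIV F)) \<and>
         cent (lp_norm p N) (lp_sum p N Y) (Pi UNIV F) = lp_sum p N (\<lambda>i. cent (N i) (Y i) (F i)) \<and>
         lp_sum p N (\<lambda>i. cent (N i) (Y i) (F i)) = (\<Pi> i\<in>UNIV. cent (N i) (Y i) (F i))"
proof -
  \<comment> \<open>A closed set lies in the topspace, here the carrier
    \<open>lp_sum p N X\<close>.\<close>
  have "Pi UNIV F \<subseteq> lp_sum p N X"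
    using assms(7) closedin_subset
      Metric_space.topspace_mtopology[OF Metric_space_lp_sum[of p X N]] assms(1,5)
    by (metis (no_types, lifting) CollectD product_CB_def CB_def CL_def is_banach_space_def)
  then interpret lp_product X F N p
    using assms(1,5,6) by unfold_locales (auto simp: is_banach_space_def)
  note c = cent_product[OF assms(2) subspace_0[OF assms(3)]]
  \<comment> \<open>After rewriting with \<open>c\<close>, the equivalence says that a product is
    nonempty iff all its factors are.\<close>
  show ?thesis
    unfolding restricted_center_property_def c by (simp add: Pi_eq_empty)
qed

end
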